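(* Let $\varphi = t \mid \phi$ be a constrained term and let $\mathcal{R}$ be a logically constrained term rewriting system (LCTRS), with transition system $(M^\Sigma, \to_{\mathcal{R}})$. Then $\llbracket \Delta_{\mathcal{R}}(\varphi) \rrbracket = \partial(\llbracket \varphi \rrbracket)$, where for a set of constrained terms $\llbracket\cdot\rrbracket$ denotes the union of their state predicate semantics.
   Context: Setting. Fix a many-sorted builtin signature $\Sigma^b=(S^b,F^b)$ whose sorts include $\mathit{Bool}$, and a builtin $\Sigma^b$-model $M^b$ with $M^b_{\mathit{Bool}}=\{\top,\bot\}$. A signature modulo builtins is a (preregular) order-sorted signature $\Sigma=(S,\le,F)$ containing $\Sigma^b$ as a subsignature, such that for each builtin sort $s\in S^b$ the constants of sort $s$ in $\Sigma$ are exactly the elements of $M^b_s$. The constructor subsignature $\Sigma^c$ has the symbols of $F\setminus F^b$ together with all constants of builtin sorts. The model $M^\Sigma$ is the $\Sigma$-model with: $M^\Sigma_s=M^b_s$ for builtin sorts, $M^\Sigma_s$ = the set of ground $\Sigma^c$-terms of sort $s$ for $s\in S\setminus S^b$; builtin function symbols interpreted as in $M^b$; every non-builtin $f$ interpreted as the term constructor $(t_1,\dots,t_n)\mapsto f(t_1,\dots,t_n)$. All carriers are assumed nonempty. $\mathcal{X}$ is an $S$-sorted set of variables. Constraint formulas (CF) are first-order formulas with equality over $\Sigma$, interpreted in $M^\Sigma$; $\mathit{var}(\phi)$ denotes free variables. A constrained term is a pair $t\mid\phi$ with $t\in T_\Sigma(\mathcal{X})$ and $\phi\in$ CF; $\llbracket\phi\rrbracket=\{\alpha:\mathcal{X}\to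 M^\Sigma \mid M^\Sigma,\alpha\models\phi\}$ and $\llbracket t\mid\phi\rrbracket=\{\alpha(t)\mid\alpha\in\llbracket\phi\rrbracket\}$. A context $c[\cdot]$ is a term with exactly one occurrence of a distinguished hole variable. An LCTRS $\mathcal{R}$ is a set of rules $l\to r \text{ if } \phi$ with $l,r\in T_\Sigma(\mathcal{X})$ of the same sort and $\phi\in$ CF; it defines the relation $u\to_{\mathcal{R}}u'$ on $M^\Sigma$ iff there are a rule $l\to r\text{ if }\phi$ in $\mathcal{R}$, a context $c[\cdot]$ and a valuation $\alpha:\mathcal{X}\to M^\Sigma$ with $u=\alpha(c[l])$, $u'=\alpha(c[r])$ and $M^\Sigma,\alpha\models\phi$. For a set $P\subseteq M^\Sigma$, $\partial(P)=\{\gamma'\mid \gamma\to_{\mathcal{R}}\gamma' \text{ for some }\gamma\in P\}$. Derivatives: for $\varphi=t\mid\phi$ and a rule $l\to r\text{ if }\phi_{lr}$ (variables renamed apart from those of $\varphi$), $\Delta_{l,r,\phi_{lr}}(\varphi)=\{c[r]\mid\phi' \;:\; \phi'\equiv \phi\wedge t=c[l]\wedge\phi_{lr},\ c[\cdot]\text{ a context of appropriate sort},\ \phi'\text{ satisfiable in }M^\Sigma\}$, and $\Delta_{\mathcal{R}}(\varphi)=\bigcup_{(l,r,\phi_{lr})\in\mathcal{R}}\Delta_{l,r,\phi_{lr}}(\varphi)$. *)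

theory Defs
  imports Main
begin

section \<open>Terms, contexts and formulas\<close>

datatype (funs: 'f, vars: 'x) trm = Var 'x | Fun 'f "('f, 'x) trm list"

primrec subst :: "('x \<Rightarrow> ('f, 'y) trm) \<Rightarrow> ('f, 'x) trm \<Rightarrow> ('f, 'y) trm" where
  "subst \<theta> (Var x) = \<theta> x"
| "subst \<theta> (Fun f ts) = Fun f (map (subst \<theta>) ts)"

primrec var_list :: "('f, 'x) trm \<Rightarrow> 'x list" where
  "var_list (Var x) = [x]"
| "var_list (Fun f ts) = concat (map var_list ts)"

text \<open>
  A context over the variables \<open>'x\<close> is a term over \<open>'x option\<close>, in which \<open>None\<close> is the
  distinguished hole variable; \<open>fill c l\<close> is \<open>c[l]\<close>.
\<close>

type_synonym ('f, 'x) ctxt = "('f, 'x option) trm"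

definition fill :: "('f, 'x) ctxt \<Rightarrow> ('f, 'x) trm \<Rightarrow> ('f, 'x) trm" where
  "fill c l = subst (case_option l Var) c"

text \<open>
  First-order formulas with equality; a term of sort \<open>Bool\<close> may be used as an atom. The
  remaining connectives and the universal quantifier are expressible from these.
\<close>

datatype ('f, 'x) fm =
    Holds "('f, 'x) trm"
  | Eq "('f, 'x) trm" "('f, 'x) trm"
  | Neg "('f, 'x) fm"
  | Conj "('f, 'x) fm" "('f, 'x) fm"
  | Exi 'x "('f, 'x) fm"

primrec fv :: "('f, 'x) fm \<Rightarrow> 'x set" where
  "fv (Holds b) = vars b"
| "fv (Eq t u) = vars t \<union> vars u"
| "fv (Neg \<phi>) = fv \<phi>"
| "fv (Conj \<phi> \<psi>) = fv \<phi> \<union> fv \<psi>"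
| "fv (Exi x \<phi>) = fv \<phi> - {x}"

type_synonym ('f, 'x) cterm = "('f, 'x) trm \<times> ('f, 'x) fm"
type_synonym ('f, 'x) crule = "('f, 'x) trm \<times> ('f, 'x) trm \<times> ('f, 'x) fm"


section \<open>Signatures modulo builtins\<close>

text \<open>
  An operation \<open>f : s\<^sub>1 \<dots> s\<^sub>n \<rightarrow> s\<close> is a triple \<open>(f, [s\<^sub>1, \<dots>, s\<^sub>n], s)\<close>; a symbol may have several
  ranks. Elements of the builtin model are themselves symbols (of type \<open>'f\<close>), since they have
  to be constants of the signature.
\<close>

type_synonym ('s, 'f) rank = "'f \<times> 's list \<times> 's"

record ('s, 'f) builtin =
  bsorts :: "'s set"
  bops :: "('s, 'f) rank set"
  bcarrier :: "'s \<Rightarrow> 'f set"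
  binterp :: "'f \<Rightarrow> 'f list \<Rightarrow> 'f"
  bool_sort :: 's
  tt :: 'f
  ff :: 'f

text \<open>The type \<open>'x\<close> together with \<open>vsort\<close> is the \<open>S\<close>-sorted set of variables.\<close>

record ('s, 'f, 'x) sig = "('s, 'f) builtin" +
  sorts :: "'s set"
  subsort :: "('s \<times> 's) set"
  ops :: "('s, 'f) rank set"
  vsort :: "'x \<Rightarrow> 's"

definition builtin_model :: "('s, 'f, 'z) builtin_scheme \<Rightarrow> bool" where
  "builtin_model \<B> \<longleftrightarrow>
     bool_sort \<B> \<in> bsorts \<B> \<and>
     bcarrier \<B> (bool_sort \<B>) = {tt \<B>, ff \<B>} \<and> tt \<B> \<noteq> ff \<B> \<and>
     (\<forall>(f, w, s) \<in> bops \<B>. set w \<subseteq> bsorts \<B> \<and> s \<in> bsorts \<B> \<and>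
        (\<forall>vs. list_all2 (\<lambda>v s'. v \<in> bcarrier \<B> s') vs w \<longrightarrow> binterp \<B> f vs \<in> bcarrier \<B> s))"

text \<open>
  \<open>has_sort G le \<tau> t s\<close>: with operations \<open>G\<close>, subsort relation \<open>le\<close> and variables sorted by
  \<open>\<tau>\<close>, \<open>t\<close> is a term of sort \<open>s\<close>.
\<close>

inductive has_sort ::
  "('s, 'f) rank set \<Rightarrow> ('s \<times> 's) set \<Rightarrow> ('x \<Rightarrow> 's) \<Rightarrow> ('f, 'x) trm \<Rightarrow> 's \<Rightarrow> bool"
  for G le \<tau> where
  var: "has_sort G le \<tau> (Var x) (\<tau> x)"
| op: "(f, w, s) \<in> G \<Longrightarrow> list_all2 (has_sort G le \<tau>) ts w \<Longrightarrow> has_sort G le \<tau> (Fun f ts) s"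
| sub: "has_sort G le \<tau> t s \<Longrightarrow> (s, s') \<in> le \<Longrightarrow> has_sort G le \<tau> t s'"
monos list_all2_mono

abbreviation term_of_sort :: "('s, 'f, 'x) sig \<Rightarrow> ('f, 'x) trm \<Rightarrow> 's \<Rightarrow> bool" where
  "term_of_sort \<Sigma> \<equiv> has_sort (ops \<Sigma>) (subsort \<Sigma>) (vsort \<Sigma>)"

definition order_sorted :: "('s, 'f, 'x) sig \<Rightarrow> bool" where
  "order_sorted \<Sigma> \<longleftrightarrow>
     partial_order_on (sorts \<Sigma>) (subsort \<Sigma>) \<and>
     (\<forall>(f, w, s) \<in> ops \<Sigma>. set w \<subseteq> sorts \<Sigma> \<and> s \<in> sorts \<Sigma>) \<and>
     (\<forall>x. vsort \<Sigma> x \<in> sorts \<Sigma>)"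

text \<open>
  Preregularity in the sense of Goguen and Meseguer: whenever \<open>f\<close> has an argument list above
  \<open>w0\<close>, there is a least result sort among the ranks of \<open>f\<close> applicable at \<open>w0\<close>.
\<close>

definition preregular :: "('s, 'f, 'x) sig \<Rightarrow> bool" where
  "preregular \<Sigma> \<longleftrightarrow>
     (\<forall>f w0 w1 s1. (f, w1, s1) \<in> ops \<Sigma> \<longrightarrow> list_all2 (\<lambda>a b. (a, b) \<in> subsort \<Sigma>) w0 w1 \<longrightarrow>
        (\<exists>s w. (f, w, s) \<in> ops \<Sigma> \<and> list_all2 (\<lambda>a b. (a, b) \<in> subsort \<Sigma>) w0 w \<and>
           (\<forall>s' w'. (f, w', s') \<in> ops \<Sigma> \<longrightarrow> list_all2 (\<lambda>a b. (a, b) \<in> subsort \<Sigma>) w0 w' \<longrightarrow>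
              (s, s') \<in> subsort \<Sigma>)))"


section \<open>The model\<close>

definition constructor_ops :: "('s, 'f, 'x) sig \<Rightarrow> ('s, 'f) rank set" where
  "constructor_ops \<Sigma> =
     (ops \<Sigma> - bops \<Sigma>) \<union> {(c, [], s) | c s. (c, [], s) \<in> ops \<Sigma> \<and> s \<in> bsorts \<Sigma>}"

text \<open>
  Elements of the model are ground terms; an element \<open>v\<close> of the builtin model is identified
  with the constant \<open>Fun v []\<close>.
\<close>

definition carrier :: "('s, 'f, 'x) sig \<Rightarrow> 's \<Rightarrow> ('f, 'x) trm set" where
  "carrier \<Sigma> s =
     (if s \<in> bsorts \<Sigma> then {Fun v [] | v. v \<in> bcarrier \<Sigma> s}
      else {a. vars a = {} \<and> has_sort (constructor_ops \<Sigma>) (subsort \<Sigma>) (vsort \<Sigma>) a s})"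

fun root :: "('f, 'x) trm \<Rightarrow> 'f" where
  "root (Fun f ts) = f"

definition interp :: "('s, 'f, 'x) sig \<Rightarrow> 'f \<Rightarrow> ('f, 'x) trm list \<Rightarrow> ('f, 'x) trm" where
  "interp \<Sigma> f as =
     (if f \<in> fst ` bops \<Sigma> then Fun (binterp \<Sigma> f (map root as)) [] else Fun f as)"

definition is_model :: "('s, 'f, 'x) sig \<Rightarrow> bool" where
  "is_model \<Sigma> \<longleftrightarrow>
     (\<forall>s \<in> sorts \<Sigma>. carrier \<Sigma> s \<noteq> {}) \<and>
     (\<forall>(s, s') \<in> subsort \<Sigma>. carrier \<Sigma> s \<subseteq> carrier \<Sigma> s') \<and>
     (\<forall>(f, w, s) \<in> ops \<Sigma>. \<forall>as. list_all2 (\<lambda>a s'. a \<in> carrier \<Sigma> s') as w \<longrightarrow>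
        interp \<Sigma> f as \<in> carrier \<Sigma> s)"

text \<open>
  A symbol is either builtin or not, so a builtin symbol gets no additional ranks (otherwise
  \<open>interp\<close>, like the notation \<open>M\<^sub>f\<close>, would be ambiguous), and a builtin constant denotes itself.
  The last conjunct is what makes the structure given by \<open>carrier\<close> and \<open>interp\<close> a model of the
  order-sorted signature (with nonempty carriers); it excludes, for instance, non-builtin
  non-constant operations with a builtin result sort.
\<close>

definition signature_modulo_builtins :: "('s, 'f, 'x) sig \<Rightarrow> bool" where
  "signature_modulo_builtins \<Sigma> \<longleftrightarrow>
     builtin_model \<Sigma> \<and> order_sorted \<Sigma> \<and> preregular \<Sigma> \<and>
     bsorts \<Sigma> \<subseteq> sorts \<Sigma> \<and> bops \<Sigma> \<subseteq> ops \<Sigma> \<and>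
     (\<forall>s \<in> bsorts \<Sigma>. {c. (c, [], s) \<in> ops \<Sigma>} = bcarrier \<Sigma> s) \<and>
     (\<forall>f w s w' s'. (f, w, s) \<in> bops \<Sigma> \<longrightarrow> (f, w', s') \<in> ops \<Sigma> \<longrightarrow> (f, w', s') \<in> bops \<Sigma>) \<and>
     (\<forall>c s. (c, [], s) \<in> bops \<Sigma> \<longrightarrow> binterp \<Sigma> c [] = c) \<and>
     is_model \<Sigma>"

definition valuations :: "('s, 'f, 'x) sig \<Rightarrow> ('x \<Rightarrow> ('f, 'x) trm) set" where
  "valuations \<Sigma> = {\<alpha>. \<forall>x. \<alpha> x \<in> carrier \<Sigma> (vsort \<Sigma> x)}"

primrec eval :: "('s, 'f, 'x) sig \<Rightarrow> ('x \<Rightarrow> ('f, 'x) trm) \<Rightarrow> ('f, 'x) trm \<Rightarrow> ('f, 'x) trm" where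
  "eval \<Sigma> \<alpha> (Var x) = \<alpha> x"
| "eval \<Sigma> \<alpha> (Fun f ts) = interp \<Sigma> f (map (eval \<Sigma> \<alpha>) ts)"

primrec sat :: "('s, 'f, 'x) sig \<Rightarrow> ('x \<Rightarrow> ('f, 'x) trm) \<Rightarrow> ('f, 'x) fm \<Rightarrow> bool" where
  "sat \<Sigma> \<alpha> (Holds b) \<longleftrightarrow> eval \<Sigma> \<alpha> b = Fun (tt \<Sigma>) []"
| "sat \<Sigma> \<alpha> (Eq t u) \<longleftrightarrow> eval \<Sigma> \<alpha> t = eval \<Sigma> \<alpha> u"
| "sat \<Sigma> \<alpha> (Neg \<phi>) \<longleftrightarrow> \<not> sat \<Sigma> \<alpha> \<phi>"
| "sat \<Sigma> \<alpha> (Conj \<phi> \<psi>) \<longleftrightarrow> sat \<Sigma> \<alpha> \<phi> \<and> sat \<Sigma> \<alpha> \<psi>"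
| "sat \<Sigma> \<alpha> (Exi x \<phi>) \<longleftrightarrow> (\<exists>a \<in> carrier \<Sigma> (vsort \<Sigma> x). sat \<Sigma> (\<alpha>(x := a)) \<phi>)"

definition fm_sem :: "('s, 'f, 'x) sig \<Rightarrow> ('f, 'x) fm \<Rightarrow> ('x \<Rightarrow> ('f, 'x) trm) set" where
  "fm_sem \<Sigma> \<phi> = {\<alpha> \<in> valuations \<Sigma>. sat \<Sigma> \<alpha> \<phi>}"


section \<open>Constrained terms and rewriting\<close>

definition well_sorted :: "('s, 'f, 'x) sig \<Rightarrow> ('f, 'x) trm \<Rightarrow> bool" where
  "well_sorted \<Sigma> t \<longleftrightarrow> (\<exists>s. term_of_sort \<Sigma> t s)"

primrec constraint_formula :: "('s, 'f, 'x) sig \<Rightarrow> ('f, 'x) fm \<Rightarrow> bool" where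
  "constraint_formula \<Sigma> (Holds b) \<longleftrightarrow> term_of_sort \<Sigma> b (bool_sort \<Sigma>)"
| "constraint_formula \<Sigma> (Eq t u) \<longleftrightarrow> well_sorted \<Sigma> t \<and> well_sorted \<Sigma> u"
| "constraint_formula \<Sigma> (Neg \<phi>) \<longleftrightarrow> constraint_formula \<Sigma> \<phi>"
| "constraint_formula \<Sigma> (Conj \<phi> \<psi>) \<longleftrightarrow> constraint_formula \<Sigma> \<phi> \<and> constraint_formula \<Sigma> \<psi>"
| "constraint_formula \<Sigma> (Exi x \<phi>) \<longleftrightarrow> constraint_formula \<Sigma> \<phi>"

fun constrained_term :: "('s, 'f, 'x) sig \<Rightarrow> ('f, 'x) cterm \<Rightarrow> bool" where
  "constrained_term \<Sigma> (t, \<phi>) \<longleftrightarrow> well_sorted \<Sigma> t \<and> constraint_formula \<Sigma> \<phi>"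

fun cterm_vars :: "('f, 'x) cterm \<Rightarrow> 'x set" where
  "cterm_vars (t, \<phi>) = vars t \<union> fv \<phi>"

fun cterm_sem :: "('s, 'f, 'x) sig \<Rightarrow> ('f, 'x) cterm \<Rightarrow> ('f, 'x) trm set" where
  "cterm_sem \<Sigma> (t, \<phi>) = {eval \<Sigma> \<alpha> t | \<alpha>. \<alpha> \<in> fm_sem \<Sigma> \<phi>}"

definition cterms_sem :: "('s, 'f, 'x) sig \<Rightarrow> ('f, 'x) cterm set \<Rightarrow> ('f, 'x) trm set" where
  "cterms_sem \<Sigma> C = (\<Union>\<phi> \<in> C. cterm_sem \<Sigma> \<phi>)"

definition LCTRS :: "('s, 'f, 'x) sig \<Rightarrow> ('f, 'x) crule set \<Rightarrow> bool" where
  "LCTRS \<Sigma> R \<longleftrightarrow>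
     (\<forall>(l, r, \<psi>) \<in> R. (\<exists>s. term_of_sort \<Sigma> l s \<and> term_of_sort \<Sigma> r s) \<and> constraint_formula \<Sigma> \<psi>)"

text \<open>\<open>h\<close> is the sort of the hole.\<close>

definition is_context :: "('s, 'f, 'x) sig \<Rightarrow> 's \<Rightarrow> ('f, 'x) ctxt \<Rightarrow> bool" where
  "is_context \<Sigma> h c \<longleftrightarrow>
     count_list (var_list c) None = 1 \<and>
     (\<exists>s. has_sort (ops \<Sigma>) (subsort \<Sigma>) (case_option h (vsort \<Sigma>)) c s)"

text \<open>The sort of the hole is any common sort of the two sides of the rule.\<close>

definition appropriate_context ::
  "('s, 'f, 'x) sig \<Rightarrow> ('f, 'x) trm \<Rightarrow> ('f, 'x) trm \<Rightarrow> ('f, 'x) ctxt \<Rightarrow> bool" where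
  "appropriate_context \<Sigma> l r c \<longleftrightarrow>
     (\<exists>h. term_of_sort \<Sigma> l h \<and> term_of_sort \<Sigma> r h \<and> is_context \<Sigma> h c)"

definition rewrite_step ::
  "('s, 'f, 'x) sig \<Rightarrow> ('f, 'x) crule set \<Rightarrow> ('f, 'x) trm \<Rightarrow> ('f, 'x) trm \<Rightarrow> bool" where
  "rewrite_step \<Sigma> R u u' \<longleftrightarrow>
     (\<exists>l r \<psi> c \<alpha>. (l, r, \<psi>) \<in> R \<and> appropriate_context \<Sigma> l r c \<and> \<alpha> \<in> valuations \<Sigma> \<and>
        u = eval \<Sigma> \<alpha> (fill c l) \<and> u' = eval \<Sigma> \<alpha> (fill c r) \<and> sat \<Sigma> \<alpha> \<psi>)"

definition successors ::
  "('s, 'f, 'x) sig \<Rightarrow> ('f, 'x) crule set \<Rightarrow> ('f, 'x) trm set \<Rightarrow> ('f, 'x) trm set" where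
  "successors \<Sigma> R P = {\<gamma>'. \<exists>\<gamma> \<in> P. rewrite_step \<Sigma> R \<gamma> \<gamma>'}"


section \<open>Derivatives\<close>

text \<open>
  A renaming is a sort-preserving permutation of the variables. It acts on all occurrences of
  variables, bound ones included, so that it cannot cause capture.
\<close>

definition renaming :: "('s, 'f, 'x) sig \<Rightarrow> ('x \<Rightarrow> 'x) \<Rightarrow> bool" where
  "renaming \<Sigma> \<rho> \<longleftrightarrow> bij \<rho> \<and> (\<forall>x. vsort \<Sigma> (\<rho> x) = vsort \<Sigma> x)"

fun rename_rule :: "('x \<Rightarrow> 'x) \<Rightarrow> ('f, 'x) crule \<Rightarrow> ('f, 'x) crule" where
  "rename_rule \<rho> (l, r, \<psi>) = (map_trm id \<rho> l, map_trm id \<rho> r, map_fm id \<rho> \<psi>)"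

fun rule_vars :: "('f, 'x) crule \<Rightarrow> 'x set" where
  "rule_vars (l, r, \<psi>) = vars l \<union> vars r \<union> fv \<psi>"

text \<open>\<open>\<rho>\<close> chooses, for every rule of \<open>R\<close>, a variant sharing no variables with \<open>\<phi>\<close>.\<close>

definition renames_apart ::
  "('s, 'f, 'x) sig \<Rightarrow> (('f, 'x) crule \<Rightarrow> 'x \<Rightarrow> 'x) \<Rightarrow> ('f, 'x) crule set \<Rightarrow> ('f, 'x) cterm \<Rightarrow> bool"
where
  "renames_apart \<Sigma> \<rho> R \<phi> \<longleftrightarrow>
     (\<forall>rl \<in> R. renaming \<Sigma> (\<rho> rl) \<and> rule_vars (rename_rule (\<rho> rl) rl) \<inter> cterm_vars \<phi> = {})"

fun rule_derivatives ::
  "('s, 'f, 'x) sig \<Rightarrow> ('f, 'x) crule \<Rightarrow> ('f, 'x) cterm \<Rightarrow> ('f, 'x) cterm set" where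
  "rule_derivatives \<Sigma> (l, r, \<psi>) (t, \<phi>) =
     {(fill c r, \<phi>') | c \<phi>'.
        \<phi>' = Conj \<phi> (Conj (Eq t (fill c l)) \<psi>) \<and>
        appropriate_context \<Sigma> l r c \<and> fm_sem \<Sigma> \<phi>' \<noteq> {}}"

definition derivatives ::
  "('s, 'f, 'x) sig \<Rightarrow> (('f, 'x) crule \<Rightarrow> 'x \<Rightarrow> 'x) \<Rightarrow> ('f, 'x) crule set \<Rightarrow>
     ('f, 'x) cterm \<Rightarrow> ('f, 'x) cterm set" where
  "derivatives \<Sigma> \<rho> R \<phi> = (\<Union>rl \<in> R. rule_derivatives \<Sigma> (rename_rule (\<rho> rl) rl) \<phi>)"

end

theory Submission
  imports Defs
begin

text \<open>
  The rule variant and the constrained term share no variables, so a valuation of the one and a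
  valuation of the other can be merged. The variables of a context, however, may clash with both,
  and there may be no fresh variables left to rename them to. Since the elements of the model are
  themselves ground terms that evaluate to themselves, every variable of the context can instead be
  replaced by its value: a rewrite step can always be performed in a context whose only variable
  is the hole.
\<close>

section \<open>Substitution and renaming\<close>

lemma subst_subst: "subst \<sigma> (subst \<theta> t) = subst (\<lambda>x. subst \<sigma> (\<theta> x)) t"
  by (induction t) auto

lemma subst_Var_comp: "subst (\<lambda>x. Var (g x)) t = map_trm id g t"
  by (induction t) auto

lemma subst_map_trm: "subst \<theta> (map_trm id g t) = subst (\<lambda>x. \<theta> (g x)) t"
  by (induction t) auto

lemma subst_Var: "subst Var t = t"
  by (induction t) (auto simp: map_idI)

lemma var_list_Nil: "vars t = {} \<Longrightarrow> var_list t = []"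
  by (induction t) auto

lemma count_list_concat: "count_list (concat xss) x = (\<Sum>xs\<leftarrow>xss. count_list xs x)"
  by (induction xss) auto

text \<open>Each occurrence of \<open>z\<close> contributes one \<open>z'\<close>, and other
  variables contribute none. With \<open>z\<close> and \<open>z'\<close> both the hole, this shows
  that grounding the variables of a context leaves exactly one hole.\<close>

lemma count_var_list_subst:
  assumes "\<And>y. count_list (var_list (\<theta> y)) z' = (if y = z then 1 else 0)"
  shows "count_list (var_list (subst \<theta> c)) z' = count_list (var_list c) z"
proof (induction c)
  case (Var y)
  then show ?case using assms by simp
next
  case (Fun f ts)
  then show ?case
    by (auto simp: count_list_concat o_def intro!: arg_cong[where f = sum_list])
qed

lemma has_sort_subst:
  assumes "has_sort G le \<tau> t s" and "\<And>x. has_sort G le \<tau>' (\<theta> x) (\<tau> x)"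
  shows "has_sort G le \<tau>' (subst \<theta> t) s"
  using assms(1)
proof induction
  case (var x)
  then show ?case by (simp add: assms(2))
next
  case (op f w s ts)
  from op(2) have "list_all2 (has_sort G le \<tau>') (map (subst \<theta>) ts) w"
    by (auto simp: list_all2_conv_all_nth)
  with op(1) show ?case by (auto intro: has_sort.op)
next
  case (sub t s s')
  then show ?case by (blast intro: has_sort.sub)
qed

lemma has_sort_map:
  assumes "has_sort G le \<tau> t s" and "\<And>x. \<tau>' (g x) = \<tau> x"
  shows "has_sort G le \<tau>' (map_trm id g t) s"
proof -
  have "has_sort G le \<tau>' (Var (g x)) (\<tau> x)" for x
    using has_sort.var[of G le \<tau>' "g x"] assms(2) by simp
  then show ?thesis
    using has_sort_subst[OF assms(1), of \<tau>' "\<lambda>x. Var (g x)"] by (simp add: subst_Var_comp)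
qed

lemma has_sort_mono:
  assumes "has_sort G le \<tau> t s" and "G \<subseteq> G'"
  shows "has_sort G' le \<tau> t s"
  using assms(1)
proof induction
  case (op f w s ts)
  from op(2) have "list_all2 (has_sort G' le \<tau>) ts w"
    by (auto simp: list_all2_conv_all_nth)
  with op(1) assms(2) show ?case by (auto intro: has_sort.op)
qed (auto intro: has_sort.var has_sort.sub)

text \<open>The inverse of a sort-preserving permutation preserves sorts too, so
  \<open>has_sort_map\<close> works in both directions. Hence a rule and its variant admit the same
  hole sorts.\<close>

lemma term_of_sort_rename_iff:
  assumes "renaming \<Sigma> g"
  shows "term_of_sort \<Sigma> (map_trm id g t) s \<longleftrightarrow> term_of_sort \<Sigma> t s"
proof
  from assms have bij: "bij g" and sort: "\<And>x. vsort \<Sigma> (g x) = vsort \<Sigma> x"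
    by (auto simp: renaming_def)
  assume "term_of_sort \<Sigma> (map_trm id g t) s"
  then have "term_of_sort \<Sigma> (map_trm id (inv g) (map_trm id g t)) s"
    by (rule has_sort_map) (metis bij sort bij_is_surj surj_f_inv_f)
  moreover have "map_trm id (inv g) (map_trm id g t) = t"
    using bij by (simp add: trm.map_comp bij_is_inj trm.map_id)
  ultimately show "term_of_sort \<Sigma> t s" by simp
next
  assume "term_of_sort \<Sigma> t s"
  then show "term_of_sort \<Sigma> (map_trm id g t) s"
    using assms by (auto intro: has_sort_map simp: renaming_def)
qed


section \<open>Evaluation and satisfaction\<close>

lemma eval_cong: "(\<And>x. x \<in> vars t \<Longrightarrow> \<alpha> x = \<beta> x) \<Longrightarrow> eval \<Sigma> \<alpha> t = eval \<Sigma> \<beta> t"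
proof (induction t)
  case (Fun f ts)
  then have "map (eval \<Sigma> \<alpha>) ts = map (eval \<Sigma> \<beta>) ts" by fastforce
  then show ?case by (simp del: map_eq_conv)
qed simp

text \<open>The two sides have separate valuations because a grounded context will be evaluated
  under a valuation other than the one that grounded it.\<close>

lemma eval_subst_cong:
  "(\<And>x. eval \<Sigma> \<alpha> (\<theta> x) = eval \<Sigma> \<beta> (\<eta> x)) \<Longrightarrow>
    eval \<Sigma> \<alpha> (subst \<theta> t) = eval \<Sigma> \<beta> (subst \<eta> t)"
proof (induction t)
  case (Fun f ts)
  then have "map (eval \<Sigma> \<alpha> \<circ> subst \<theta>) ts = map (eval \<Sigma> \<beta> \<circ> subst \<eta>) ts" by simp
  then show ?case by (simp del: map_eq_conv)
qed simp

lemma eval_map: "eval \<Sigma> \<alpha> (map_trm id g t) = eval \<Sigma> (\<alpha> \<circ> g) t"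
  \<comment> \<open>Renaming is substitution by variables, and \<open>t\<close> is its own instance
    under \<open>Var\<close>, so the congruence relates the two.\<close>
  using eval_subst_cong[of \<Sigma> \<alpha> "\<lambda>x. Var (g x)" "\<alpha> \<circ> g" Var t]
  unfolding subst_Var unfolding subst_Var_comp by simp

lemma sat_cong: "(\<And>x. x \<in> fv \<phi> \<Longrightarrow> \<alpha> x = \<beta> x) \<Longrightarrow> sat \<Sigma> \<alpha> \<phi> \<longleftrightarrow> sat \<Sigma> \<beta> \<phi>"
proof (induction \<phi> arbitrary: \<alpha> \<beta>)
  case (Holds b)
  then show ?case using eval_cong[of b \<alpha> \<beta> \<Sigma>] by simp
next
  case (Eq t u)
  then show ?case using eval_cong[of t \<alpha> \<beta> \<Sigma>] eval_cong[of u \<alpha> \<beta> \<Sigma>] by simp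
next
  case (Neg \<phi>)
  have "sat \<Sigma> \<alpha> \<phi> \<longleftrightarrow> sat \<Sigma> \<beta> \<phi>"
    by (rule Neg.IH) (use Neg.prems in simp)
  then show ?case by simp
next
  case (Conj \<phi> \<psi>)
  have "sat \<Sigma> \<alpha> \<phi> \<longleftrightarrow> sat \<Sigma> \<beta> \<phi>"
    by (rule Conj.IH(1)) (use Conj.prems in simp)
  moreover have "sat \<Sigma> \<alpha> \<psi> \<longleftrightarrow> sat \<Sigma> \<beta> \<psi>"
    by (rule Conj.IH(2)) (use Conj.prems in simp)
  ultimately show ?case by simp
next
  case (Exi x \<phi>)
  have "sat \<Sigma> (\<alpha>(x := a)) \<phi> \<longleftrightarrow> sat \<Sigma> (\<beta>(x := a)) \<phi>" for a
    by (rule Exi.IH) (use Exi.prems in auto)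
  then show ?case by simp
qed

text \<open>Bound variables are renamed as well: injectivity of \<open>g\<close> turns an update at
  \<open>g x\<close> into one at \<open>x\<close>, and sort preservation keeps the range of the
  quantifier.\<close>

lemma sat_map:
  assumes "renaming \<Sigma> g"
  shows "sat \<Sigma> \<alpha> (map_fm id g \<phi>) \<longleftrightarrow> sat \<Sigma> (\<alpha> \<circ> g) \<phi>"
proof (induction \<phi> arbitrary: \<alpha>)
  case (Exi x \<phi>)
  have "\<alpha>(g x := a) \<circ> g = (\<alpha> \<circ> g)(x := a)" for a
    using assms by (auto simp: renaming_def fun_eq_iff bij_def inj_eq)
  moreover have "vsort \<Sigma> (g x) = vsort \<Sigma> x"
    using assms by (simp add: renaming_def)
  ultimately show ?case
    by (simp only: fm.map sat.simps Exi.IH)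
qed (simp_all add: eval_map)

lemma valuations_comp:
  "renaming \<Sigma> g \<Longrightarrow> \<alpha> \<in> valuations \<Sigma> \<Longrightarrow> \<alpha> \<circ> g \<in> valuations \<Sigma>"
  unfolding valuations_def renaming_def by (simp, metis)

lemma renaming_inv: "renaming \<Sigma> g \<Longrightarrow> renaming \<Sigma> (inv g)"
  unfolding renaming_def by (metis bij_imp_bij_inv bij_is_surj surj_f_inv_f)


section \<open>Elements of the model as terms\<close>

text \<open>All ranks of a builtin symbol are builtin, so \<open>binterp\<close> fixes such a
  constant; any other constant is interpreted by term formation.\<close>

lemma interp_builtin_constant:
  assumes "signature_modulo_builtins \<Sigma>" and "(v, [], s) \<in> ops \<Sigma>"
  shows "interp \<Sigma> v [] = Fun v []"
  using assms unfolding signature_modulo_builtins_def interp_def by fastforce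

lemma carrier_ground: "a \<in> carrier \<Sigma> s \<Longrightarrow> vars a = {}"
  by (auto simp: carrier_def split: if_splits)

text \<open>Builtin values are constants of the signature, and constructors are among its
  operations. So values can be substituted for variables without changing sorts.\<close>

lemma carrier_term_of_sort:
  assumes "signature_modulo_builtins \<Sigma>" and "a \<in> carrier \<Sigma> s"
  shows "term_of_sort \<Sigma> a s"
proof (cases "s \<in> bsorts \<Sigma>")
  case True
  with assms(2) obtain v where v: "a = Fun v []" "v \<in> bcarrier \<Sigma> s"
    by (auto simp: carrier_def)
  moreover have "(v, [], s) \<in> ops \<Sigma>"
    using assms(1) True v(2) unfolding signature_modulo_builtins_def by blast
  ultimately show ?thesis by (auto intro: has_sort.op)
next
  case False
  with assms(2) have "has_sort (constructor_ops \<Sigma>) (subsort \<Sigma>) (vsort \<Sigma>) a s"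
    by (auto simp: carrier_def)
  then show ?thesis
    by (rule has_sort_mono) (auto simp: constructor_ops_def)
qed

text \<open>Constructors act as term formation, so evaluation rebuilds a ground constructor term
  from its leaves.\<close>

lemma eval_constructor_term:
  assumes "signature_modulo_builtins \<Sigma>"
    and "has_sort (constructor_ops \<Sigma>) (subsort \<Sigma>) (vsort \<Sigma>) a s" and "vars a = {}"
  shows "eval \<Sigma> \<alpha> a = a"
  using assms(2,3)
proof induction
  case (op f w s ts)
  have "eval \<Sigma> \<alpha> u = u" if "u \<in> set ts" for u
    using op(2) op.prems that by (fastforce simp: list_all2_conv_all_nth in_set_conv_nth)
  then have args: "map (eval \<Sigma> \<alpha>) ts = ts" by (simp add: map_idI)
  have "interp \<Sigma> f ts = Fun f ts"
  \<comment> \<open>A rank outside \<open>bops\<close> belongs to a non-builtin symbol; the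
    remaining constructors are constants.\<close>
  proof (cases "(f, w, s) \<in> ops \<Sigma> - bops \<Sigma>")
    case True
    then have "f \<notin> fst ` bops \<Sigma>"
      using assms(1) unfolding signature_modulo_builtins_def by fastforce
    then show ?thesis by (simp add: interp_def)
  next
    case False
    with op(1) have "w = []" "(f, [], s) \<in> ops \<Sigma>" by (auto simp: constructor_ops_def)
    moreover from this op(2) have "ts = []" by simp
    ultimately show ?thesis using interp_builtin_constant[OF assms(1)] by simp
  qed
  with args show ?case by simp
qed auto

lemma eval_carrier:
  assumes "signature_modulo_builtins \<Sigma>" and "a \<in> carrier \<Sigma> s"
  shows "eval \<Sigma> \<alpha> a = a"
proof (cases "s \<in> bsorts \<Sigma>")
  case True
  with assms(2) obtain v where v: "a = Fun v []" "v \<in> bcarrier \<Sigma> s"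
    by (auto simp: carrier_def)
  moreover have "(v, [], s) \<in> ops \<Sigma>"
    using assms(1) True v(2) unfolding signature_modulo_builtins_def by blast
  ultimately show ?thesis using interp_builtin_constant[OF assms(1)] by simp
next
  case False
  with assms show ?thesis by (auto simp: carrier_def intro: eval_constructor_term)
qed


section \<open>Rewriting in contexts without variables\<close>

text \<open>The context \<open>d\<close> is \<open>c\<close> with every variable replaced by its
  value under \<alpha>. As \<open>d\<close> no longer depends on a valuation, one \<open>d\<close>
  serves both sides of a rule and any \<beta>.\<close>

lemma ground_context:
  assumes \<Sigma>: "signature_modulo_builtins \<Sigma>" and c: "is_context \<Sigma> h c"
    and \<alpha>: "\<alpha> \<in> valuations \<Sigma>"
  obtains d where "is_context \<Sigma> h d"
    and "\<forall>\<beta> u v. eval \<Sigma> \<beta> u = eval \<Sigma> \<alpha> v \<longrightarrow> eval \<Sigma> \<beta> (fill d u) = eval \<Sigma> \<alpha> (fill c v)"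
proof -
  \<comment> \<open>The hole stays; \<open>map_trm id Some\<close> only moves the ground value
    \<open>\<alpha> x\<close> to the variable type of contexts.\<close>
  define \<theta> where "\<theta> = case_option (Var None) (\<lambda>x. map_trm id Some (\<alpha> x))"
  from \<alpha> have val: "\<alpha> x \<in> carrier \<Sigma> (vsort \<Sigma> x)" for x
    by (simp add: valuations_def)
  have "vars (map_trm id Some (\<alpha> x)) = {}" for x
    using carrier_ground[OF val] by (simp add: trm.set_map)
  then have "count_list (var_list (\<theta> y)) None = (if y = None then 1 else 0)" for y
    by (auto simp: \<theta>_def var_list_Nil split: option.split)
  then have count: "count_list (var_list (subst \<theta> c)) None = count_list (var_list c) None"
    by (rule count_var_list_subst)
  let ?\<tau> = "case_option h (vsort \<Sigma>)"
  have "has_sort (ops \<Sigma>) (subsort \<Sigma>) ?\<tau> (\<theta> y) (?\<tau> y)" for y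
    using has_sort.var[of "ops \<Sigma>" "subsort \<Sigma>" ?\<tau> None]
    by (auto simp: \<theta>_def intro!: has_sort_map carrier_term_of_sort[OF \<Sigma> val] split: option.split)
  with c count have "is_context \<Sigma> h (subst \<theta> c)"
    unfolding is_context_def by (metis has_sort_subst)
  moreover have "eval \<Sigma> \<beta> (fill (subst \<theta> c) u) = eval \<Sigma> \<alpha> (fill c v)"
    if uv: "eval \<Sigma> \<beta> u = eval \<Sigma> \<alpha> v" for \<beta> u v
  proof -
    \<comment> \<open>At the hole this is \<open>uv\<close>; elsewhere both sides are the value
      \<open>\<alpha> x\<close>, which evaluates to itself under \<beta>.\<close>
    have "eval \<Sigma> \<beta> (subst (case_option u Var) (\<theta> y)) = eval \<Sigma> \<alpha> (case_option v Var y)" for y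
      using uv eval_carrier[OF \<Sigma> val]
      by (auto simp: \<theta>_def subst_map_trm subst_Var split: option.split)
    then show ?thesis
      unfolding fill_def subst_subst by (rule eval_subst_cong)
  qed
  ultimately show thesis by (blast intro: that)
qed

text \<open>The primed sides allow the grounded context to pass from a rule to its variant or
  back.\<close>

lemma ground_appropriate_context:
  assumes "signature_modulo_builtins \<Sigma>" and "appropriate_context \<Sigma> l r c"
    and "\<alpha> \<in> valuations \<Sigma>"
    and "\<And>h. term_of_sort \<Sigma> l h \<Longrightarrow> term_of_sort \<Sigma> l' h"
    and "\<And>h. term_of_sort \<Sigma> r h \<Longrightarrow> term_of_sort \<Sigma> r' h"
  obtains d where "appropriate_context \<Sigma> l' r' d"
    and "\<forall>\<beta> u v. eval \<Sigma> \<beta> u = eval \<Sigma> \<alpha> v \<longrightarrow> eval \<Sigma> \<beta> (fill d u) = eval \<Sigma> \<alpha> (fill c v)"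
proof -
  from assms(2) obtain h where "term_of_sort \<Sigma> l h" "term_of_sort \<Sigma> r h" "is_context \<Sigma> h c"
    by (auto simp: appropriate_context_def)
  moreover from assms(1) this(3) assms(3) obtain d where "is_context \<Sigma> h d"
    and "\<forall>\<beta> u v. eval \<Sigma> \<beta> u = eval \<Sigma> \<alpha> v \<longrightarrow> eval \<Sigma> \<beta> (fill d u) = eval \<Sigma> \<alpha> (fill c v)"
    by (rule ground_context)
  ultimately show thesis
    using assms(4,5) that unfolding appropriate_context_def by blast
qed

theorem theorem1:
  fixes \<Sigma> :: "('s, 'f, 'x) sig"
    and R :: "('f, 'x) crule set"
    and t :: "('f, 'x) trm" and \<phi> :: "('f, 'x) fm"
    and \<rho> :: "('f, 'x) crule \<Rightarrow> 'x \<Rightarrow> 'x"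
  assumes "signature_modulo_builtins \<Sigma>"
    and "constrained_term \<Sigma> (t, \<phi>)"
    and "LCTRS \<Sigma> R"
    and "renames_apart \<Sigma> \<rho> R (t, \<phi>)"
  shows "cterms_sem \<Sigma> (derivatives \<Sigma> \<rho> R (t, \<phi>)) = successors \<Sigma> R (cterm_sem \<Sigma> (t, \<phi>))"
proof (intro equalityI subsetI)
  fix \<gamma>'
  assume "\<gamma>' \<in> cterms_sem \<Sigma> (derivatives \<Sigma> \<rho> R (t, \<phi>))"
  then obtain l r \<psi> g c \<alpha> where rule: "(l, r, \<psi>) \<in> R" and g: "g = \<rho> (l, r, \<psi>)"
    and c: "appropriate_context \<Sigma> (map_trm id g l) (map_trm id g r) c"
    and \<alpha>: "\<alpha> \<in> valuations \<Sigma>" "sat \<Sigma> \<alpha> \<phi>" "sat \<Sigma> \<alpha> (map_fm id g \<psi>)"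
      "eval \<Sigma> \<alpha> t = eval \<Sigma> \<alpha> (fill c (map_trm id g l))"
    and \<gamma>': "\<gamma>' = eval \<Sigma> \<alpha> (fill c (map_trm id g r))"
    by (fastforce simp: cterms_sem_def derivatives_def fm_sem_def)
  have ren: "renaming \<Sigma> g"
    using assms(4) rule g by (auto simp: renames_apart_def)
  \<comment> \<open>The context of the variant is grounded under \<alpha>, so that it also fits the
    original rule, which is applied under \<open>\<alpha> \<circ> g\<close>.\<close>
  obtain d where d: "appropriate_context \<Sigma> l r d"
    and fill: "\<forall>\<beta> u v. eval \<Sigma> \<beta> u = eval \<Sigma> \<alpha> v \<longrightarrow>
      eval \<Sigma> \<beta> (fill d u) = eval \<Sigma> \<alpha> (fill c v)"
    using assms(1) c \<alpha>(1)
    by (rule ground_appropriate_context[where l' = l and r' = r]) (simp_all add: term_of_sort_rename_iff[OF ren])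
  have "rewrite_step \<Sigma> R (eval \<Sigma> \<alpha> t) \<gamma>'"
    unfolding rewrite_step_def
  proof (intro exI conjI)
    show "(l, r, \<psi>) \<in> R" "appropriate_context \<Sigma> l r d" by fact+
    show "\<alpha> \<circ> g \<in> valuations \<Sigma>" using ren \<alpha>(1) by (rule valuations_comp)
    show "eval \<Sigma> \<alpha> t = eval \<Sigma> (\<alpha> \<circ> g) (fill d l)"
      unfolding \<alpha>(4) by (rule fill[rule_format, symmetric]) (simp add: eval_map)
    show "\<gamma>' = eval \<Sigma> (\<alpha> \<circ> g) (fill d r)"
      unfolding \<gamma>' by (rule fill[rule_format, symmetric]) (simp add: eval_map)
    show "sat \<Sigma> (\<alpha> \<circ> g) \<psi>" using \<alpha>(3) by (simp add: sat_map[OF ren])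
  qed
  with \<alpha>(1,2) show "\<gamma>' \<in> successors \<Sigma> R (cterm_sem \<Sigma> (t, \<phi>))"
    by (auto simp: successors_def fm_sem_def)
next
  fix \<gamma>'
  assume "\<gamma>' \<in> successors \<Sigma> R (cterm_sem \<Sigma> (t, \<phi>))"
  \<comment> \<open>The valuation \<alpha> instantiates the constrained term and \<beta> the rule;
    they need only agree on the value of the redex term.\<close>
  then obtain \<alpha> l r \<psi> c \<beta> where \<alpha>: "\<alpha> \<in> valuations \<Sigma>" "sat \<Sigma> \<alpha> \<phi>"
    and rule: "(l, r, \<psi>) \<in> R" and c: "appropriate_context \<Sigma> l r c"
    and \<beta>: "\<beta> \<in> valuations \<Sigma>" "sat \<Sigma> \<beta> \<psi>" "eval \<Sigma> \<alpha> t = eval \<Sigma> \<beta> (fill c l)"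
    and \<gamma>': "\<gamma>' = eval \<Sigma> \<beta> (fill c r)"
    by (auto simp: successors_def fm_sem_def rewrite_step_def)
  define g where "g = \<rho> (l, r, \<psi>)"
  define l' r' \<psi>' where "l' = map_trm id g l" and "r' = map_trm id g r" and "\<psi>' = map_fm id g \<psi>"
  have ren: "renaming \<Sigma> g" and apart: "rule_vars (l', r', \<psi>') \<inter> cterm_vars (t, \<phi>) = {}"
    using assms(4) rule by (fastforce simp: renames_apart_def g_def l'_def r'_def \<psi>'_def)+
  obtain d where d: "appropriate_context \<Sigma> l' r' d"
    and fill: "\<forall>\<delta> u v. eval \<Sigma> \<delta> u = eval \<Sigma> \<beta> v \<longrightarrow>
      eval \<Sigma> \<delta> (fill d u) = eval \<Sigma> \<beta> (fill c v)"
    using assms(1) c \<beta>(1)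
    by (rule ground_appropriate_context[where l' = l' and r' = r'])
      (simp_all add: l'_def r'_def term_of_sort_rename_iff[OF ren])
  \<comment> \<open>Undoing the renaming makes the variant under \<open>\<beta>'\<close> behave like
    the original rule under \<beta>.\<close>
  define \<beta>' where "\<beta>' = \<beta> \<circ> inv g"
  have \<beta>'_val: "\<beta>' \<in> valuations \<Sigma>"
    unfolding \<beta>'_def using renaming_inv[OF ren] \<beta>(1) by (rule valuations_comp)
  have \<beta>'_g: "\<beta>' \<circ> g = \<beta>"
    using ren by (simp add: \<beta>'_def renaming_def bij_is_inj comp_assoc)
  \<comment> \<open>The merged valuation: disjointness of variables makes it agree with \<alpha> on
    the constrained term and with \<open>\<beta>'\<close> on the variant. The ground context
    \<open>d\<close> is indifferent to it.\<close>
  define \<delta> where "\<delta> = (\<lambda>x. if x \<in> cterm_vars (t, \<phi>) then \<alpha> x else \<beta>' x)"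
  have \<delta>_\<alpha>: "\<delta> x = \<alpha> x" if "x \<in> cterm_vars (t, \<phi>)" for x
    using that by (simp add: \<delta>_def)
  have \<delta>_\<beta>': "\<delta> x = \<beta>' x" if "x \<in> rule_vars (l', r', \<psi>')" for x
    using that apart unfolding \<delta>_def by (simp only: disjoint_iff if_False)
  have \<delta>: "\<delta> \<in> valuations \<Sigma>"
    using \<alpha>(1) \<beta>'_val by (auto simp: valuations_def \<delta>_def)
  have t: "eval \<Sigma> \<delta> t = eval \<Sigma> \<alpha> t" by (rule eval_cong) (simp add: \<delta>_\<alpha>)
  have "eval \<Sigma> \<delta> l' = eval \<Sigma> \<beta>' l'" by (rule eval_cong) (simp add: \<delta>_\<beta>')
  then have l: "eval \<Sigma> \<delta> (fill d l') = eval \<Sigma> \<beta> (fill c l)"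
    by (intro fill[rule_format]) (simp add: l'_def eval_map \<beta>'_g)
  have "eval \<Sigma> \<delta> r' = eval \<Sigma> \<beta>' r'" by (rule eval_cong) (simp add: \<delta>_\<beta>')
  then have r: "eval \<Sigma> \<delta> (fill d r') = \<gamma>'"
    unfolding \<gamma>' by (intro fill[rule_format]) (simp add: r'_def eval_map \<beta>'_g)
  have "sat \<Sigma> \<delta> \<phi> \<longleftrightarrow> sat \<Sigma> \<alpha> \<phi>" by (rule sat_cong) (simp add: \<delta>_\<alpha>)
  moreover have "sat \<Sigma> \<delta> \<psi>' \<longleftrightarrow> sat \<Sigma> \<beta>' \<psi>'" by (rule sat_cong) (simp add: \<delta>_\<beta>')
  \<comment> \<open>The equation holds because both of its sides evaluate to the source of the step.
    Thus \<delta> both shows the derivative satisfiable and yields \<open>\<gamma>'\<close> as one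
    of its instances.\<close>
  ultimately have sem: "\<delta> \<in> fm_sem \<Sigma> (Conj \<phi> (Conj (Eq t (fill d l')) \<psi>'))"
    using \<delta> \<alpha>(2) \<beta>(2,3) t l by (simp add: fm_sem_def \<psi>'_def sat_map[OF ren] \<beta>'_g)
  have "(fill d r', Conj \<phi> (Conj (Eq t (fill d l')) \<psi>')) \<in> rule_derivatives \<Sigma> (l', r', \<psi>') (t, \<phi>)"
    using d sem by auto
  then have "(fill d r', Conj \<phi> (Conj (Eq t (fill d l')) \<psi>')) \<in> derivatives \<Sigma> \<rho> R (t, \<phi>)"
    unfolding derivatives_def using rule
    by (auto simp del: rule_derivatives.simps simp: g_def l'_def r'_def \<psi>'_def intro!: bexI)
  moreover have "\<gamma>' \<in> cterm_sem \<Sigma> (fill d r', Conj \<phi> (Conj (Eq t (fill d l')) \<psi>'))"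
    using sem r by auto
  ultimately show "\<gamma>' \<in> cterms_sem \<Sigma> (derivatives \<Sigma> \<rho> R (t, \<phi>))"
    unfolding cterms_sem_def by blast
qed

end
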